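(* Each of the families $\{z_{A,\emptyset}\}$ and $\{z_{\emptyset,A}\}$, with $A$ running over all nonempty subsets of $\{1,\dots,n\}$, is a basis for $T_n$. Another basis of $T_n$ is given by the elements $z_{A,\bar A}$, with $A$ running over all nonempty subsets of $\{1,\dots,n\}$, where $\bar A=\{1,\dots,n\}\setminus A$.
   Context: Let $k$ be a field and $n\ge 1$. $Q_n$ is the associative unital $k$-algebra with generators $z_{A,i}$, for $A\subseteq\{1,\dots,n\}$ and $i\in\{1,\dots,n\}\setminus A$, and defining relations $$z_{A\cup\{i\},j}+z_{A,i}=z_{A\cup\{j\},i}+z_{A,j},\qquad z_{A\cup\{i\},j}\,z_{A,i}=z_{A\cup\{j\},i}\,z_{A,j}$$ for all $A$ and all distinct $i,j\notin A$. $T_n\subseteq Q_n$ is the $k$-linear span of all $z_{A,i}$, and $\bar T_n=T_n\oplus k\cdot1$. $K_n=k[v_1,\dots,v_n]/(v_i^2+v_i:1\le i\le n)$, and $w_i$ is the image of $v_i$. There is an algebra homomorphism $\phi:Q_n\to K_n$ with $\phi(z_{A,i})=w_i\prod_{j\in A}(1+w_j)$, and its restriction $\phi|_{\bar T_n}:\bar T_n\to K_n$ is an isomorphism of vector spaces. For $A,B\subseteq\{1,\dots,n\}$, $z_{A,B}$ is the projection to $T_n$ (along $k\cdot 1$) of $(\phi|_{\bar T_n})^{-1}\big(\prod_{i\in B}w_i\prod_{j\in A}(1+w_j)\big)$. *)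

theory Defs
  imports Complex_Main "HOL-Library.Poly_Mapping"
begin

text \<open>
  The index set \<open>{1, \<dots>, n}\<close>, with \<open>n \<ge> 1\<close>, is a type \<open>'n::finite\<close> with \<open>n\<close> elements, so subsets
  of \<open>{1, \<dots>, n}\<close> are sets of type \<open>'n set\<close> and \<open>\<bar>A\<close> is the complement \<open>- A\<close>.
\<close>


section \<open>Two-sided ideals\<close>

definition two_sided_ideal :: "'a::ring_1 set \<Rightarrow> bool" where
  "two_sided_ideal I \<longleftrightarrow>
     0 \<in> I \<and> (\<forall>x\<in>I. \<forall>y\<in>I. x + y \<in> I) \<and> (\<forall>x\<in>I. \<forall>a. a * x \<in> I \<and> x * a \<in> I)"

lemma two_sided_ideal_hull: "two_sided_ideal (two_sided_ideal hull S)"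
  by (rule hull_in) (auto simp: two_sided_ideal_def)

definition ideal_rel :: "'a::ring_1 set \<Rightarrow> 'a \<Rightarrow> 'a \<Rightarrow> bool" where
  "ideal_rel S x y \<longleftrightarrow> x - y \<in> two_sided_ideal hull S"

context
  fixes S :: "'a::ring_1 set"
begin

private abbreviation "I \<equiv> two_sided_ideal hull S"

private lemma I_add: "x \<in> I \<Longrightarrow> y \<in> I \<Longrightarrow> x + y \<in> I"
  and I_zero: "0 \<in> I"
  and I_left: "x \<in> I \<Longrightarrow> a * x \<in> I"
  and I_right: "x \<in> I \<Longrightarrow> x * a \<in> I"
  using two_sided_ideal_hull[of S] by (auto simp: two_sided_ideal_def)

private lemma I_uminus: "x \<in> I \<Longrightarrow> - x \<in> I"
  using I_left[of x "-1"] by simp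

lemma ideal_rel_generator: "x - y \<in> S \<Longrightarrow> ideal_rel S x y"
  by (simp add: ideal_rel_def hull_inc)

lemma ideal_rel_equivp: "equivp (ideal_rel S)"
proof (rule equivpI)
  show "reflp (ideal_rel S)"
    by (simp add: reflp_def ideal_rel_def I_zero)
  show "symp (ideal_rel S)"
    unfolding symp_def ideal_rel_def using I_uminus by (metis minus_diff_eq)
  show "transp (ideal_rel S)"
  proof (rule transpI)
    fix x y z
    assume "ideal_rel S x y" "ideal_rel S y z"
    then have "(x - y) + (y - z) \<in> I"
      unfolding ideal_rel_def by (rule I_add)
    then show "ideal_rel S x z"
      by (simp add: ideal_rel_def)
  qed
qed

lemma ideal_rel_refl: "ideal_rel S x x"
  by (simp add: ideal_rel_def I_zero)

lemma ideal_rel_add: "ideal_rel S x x' \<Longrightarrow> ideal_rel S y y' \<Longrightarrow> ideal_rel S (x + y) (x' + y')"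
  unfolding ideal_rel_def using I_add[of "x - x'" "y - y'"] by (simp add: algebra_simps)

lemma ideal_rel_uminus: "ideal_rel S x x' \<Longrightarrow> ideal_rel S (- x) (- x')"
  unfolding ideal_rel_def using I_uminus[of "x - x'"] by simp

lemma ideal_rel_diff: "ideal_rel S x x' \<Longrightarrow> ideal_rel S y y' \<Longrightarrow> ideal_rel S (x - y) (x' - y')"
  using ideal_rel_add[of x x' "- y" "- y'"] ideal_rel_uminus[of y y'] by simp

lemma ideal_rel_mult:
  assumes "ideal_rel S x x'" "ideal_rel S y y'"
  shows "ideal_rel S (x * y) (x' * y')"
proof -
  have "(x - x') * y + x' * (y - y') \<in> I"
    using assms by (intro I_add I_left I_right) (auto simp: ideal_rel_def)
  then show ?thesis
    by (simp add: ideal_rel_def algebra_simps)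
qed

end


section \<open>Monoid algebras\<close>

lemma poly_mapping_add_induct [case_names zero single add]:
  fixes p :: "'m \<Rightarrow>\<^sub>0 'k::comm_monoid_add"
  assumes "P 0" "\<And>m c. P (Poly_Mapping.single m c)" "\<And>p q. P p \<Longrightarrow> P q \<Longrightarrow> P (p + q)"
  shows "P p"
proof (induction p rule: update_induct)
  case const
  show ?case by (rule assms(1))
next
  case (update f a b)
  have "Poly_Mapping.update a b f = f + Poly_Mapping.single a b"
    using update(1)
    by (intro poly_mapping_eqI) (auto simp: lookup_update lookup_add lookup_single when_def in_keys_iff)
  with assms update show ?case by metis
qed

lemma single_zero_central:
  fixes c :: "'k::comm_semiring_1" and p :: "'m::monoid_add \<Rightarrow>\<^sub>0 'k"
  shows "Poly_Mapping.single 0 c * p = p * Poly_Mapping.single 0 c"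
  by (induction p rule: poly_mapping_add_induct)
     (simp_all add: mult_single mult.commute distrib_left distrib_right)

definition monoid_algebra_eval ::
    "('k \<Rightarrow> 'a) \<Rightarrow> ('m \<Rightarrow> 'a) \<Rightarrow> ('m::monoid_add \<Rightarrow>\<^sub>0 'k::comm_ring_1) \<Rightarrow> 'a::ring_1" where
  "monoid_algebra_eval \<iota> h p = (\<Sum>m\<in>Poly_Mapping.keys p. \<iota> (Poly_Mapping.lookup p m) * h m)"

locale monoid_algebra_hom =
  fixes \<iota> :: "'k::comm_ring_1 \<Rightarrow> 'a::ring_1" and h :: "'m::monoid_add \<Rightarrow> 'a"
  assumes \<iota>_add: "\<iota> (c + d) = \<iota> c + \<iota> d"
    and \<iota>_mult: "\<iota> (c * d) = \<iota> c * \<iota> d"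
    and \<iota>_one: "\<iota> 1 = 1"
    and \<iota>_central: "\<iota> c * x = x * \<iota> c"
    and h_zero: "h 0 = 1"
    and h_add: "h (m + m') = h m * h m'"
begin

abbreviation "ev \<equiv> monoid_algebra_eval \<iota> h"

lemma \<iota>_zero: "\<iota> 0 = 0"
  using \<iota>_add[of 0 0] by simp

lemma eval_single: "ev (Poly_Mapping.single m c) = \<iota> c * h m"
  by (simp add: monoid_algebra_eval_def \<iota>_zero)

lemma eval_zero: "ev 0 = 0"
  by (simp add: monoid_algebra_eval_def)

lemma eval_one: "ev 1 = 1"
  using eval_single[of 0 1] by (simp add: \<iota>_one h_zero)

lemma eval_add: "ev (p + q) = ev p + ev q"
  unfolding monoid_algebra_eval_def
  by (rule setsum_keys_plus_distrib) (simp_all add: \<iota>_zero \<iota>_add distrib_right)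

lemma eval_diff: "ev (p - q) = ev p - ev q"
  using eval_add[of "p - q" q] by simp

lemma eval_mult: "ev (p * q) = ev p * ev q"
proof (induction p rule: poly_mapping_add_induct)
  case (single m c)
  show ?case
  proof (induction q rule: poly_mapping_add_induct)
    case (single m' c')
    have "\<iota> c * \<iota> c' * (h m * h m') = \<iota> c * h m * (\<iota> c' * h m')"
      by (metis \<iota>_central mult.assoc)
    then show ?case
      by (simp add: mult_single eval_single \<iota>_mult h_add)
  qed (simp_all add: eval_zero eval_add distrib_left)
qed (simp_all add: eval_zero eval_add distrib_right)

lemma eval_ideal_rel:
  assumes "\<And>s. s \<in> S \<Longrightarrow> ev s = 0" "ideal_rel S p q"
  shows "ev p = ev q"
proof -
  have "two_sided_ideal hull S \<subseteq> {p. ev p = 0}"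
    using assms(1)
    by (intro hull_minimal) (auto simp: two_sided_ideal_def eval_zero eval_add eval_mult)
  then show ?thesis
    using assms(2) by (auto simp: ideal_rel_def eval_diff)
qed

end


section \<open>The algebra \<open>K\<^sub>n\<close>\<close>

text \<open>The polynomial ring \<open>k[v\<^sub>1, \<dots>, v\<^sub>n]\<close> is \<open>('n \<Rightarrow>\<^sub>0 nat) \<Rightarrow>\<^sub>0 'k\<close>.\<close>

definition Kvar :: "'n \<Rightarrow> (('n \<Rightarrow>\<^sub>0 nat) \<Rightarrow>\<^sub>0 'k::field)" where
  "Kvar i = Poly_Mapping.single (Poly_Mapping.single i 1) 1"

definition K_relators :: "(('n \<Rightarrow>\<^sub>0 nat) \<Rightarrow>\<^sub>0 'k::field) set" where
  "K_relators = {Kvar i ^ 2 + Kvar i | i. True}"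

quotient_type (overloaded) ('k, 'n) K = "('n \<Rightarrow>\<^sub>0 nat) \<Rightarrow>\<^sub>0 'k::field" / "ideal_rel K_relators"
  by (rule ideal_rel_equivp)

lemma K_one_nontrivial: "\<not> ideal_rel (K_relators :: (('n \<Rightarrow>\<^sub>0 nat) \<Rightarrow>\<^sub>0 'k::field) set) 0 1"
proof
  interpret monoid_algebra_hom "\<lambda>c::'k. c" "\<lambda>m::'n \<Rightarrow>\<^sub>0 nat. of_bool (m = 0) :: 'k"
  proof
    fix m m' :: "'n \<Rightarrow>\<^sub>0 nat"
    have "m + m' = 0 \<longleftrightarrow> m = 0 \<and> m' = 0"
      by (auto simp: poly_mapping_eq_iff lookup_add fun_eq_iff)
    then show "of_bool (m + m' = 0) = (of_bool (m = 0) * of_bool (m' = 0) :: 'k)"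
      by simp
  qed (simp_all add: mult.commute)
  have "Poly_Mapping.single i 1 \<noteq> (0 :: 'n \<Rightarrow>\<^sub>0 nat)" for i
    by (metis lookup_single_eq lookup_zero zero_neq_one)
  then have "ev s = 0" if "s \<in> K_relators" for s
    using that
    by (auto simp: K_relators_def Kvar_def eval_add eval_mult power2_eq_square eval_single)
  moreover assume "ideal_rel (K_relators :: (('n \<Rightarrow>\<^sub>0 nat) \<Rightarrow>\<^sub>0 'k) set) 0 1"
  ultimately have "ev 0 = ev 1"
    by (rule eval_ideal_rel)
  then show False
    by (simp add: eval_zero eval_one)
qed

instantiation K :: (field, type) comm_ring_1
begin

lift_definition zero_K :: "('a, 'b) K" is 0 .
lift_definition one_K :: "('a, 'b) K" is 1 .
lift_definition plus_K :: "('a, 'b) K \<Rightarrow> ('a, 'b) K \<Rightarrow> ('a, 'b) K" is "(+)"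
  by (rule ideal_rel_add)
lift_definition uminus_K :: "('a, 'b) K \<Rightarrow> ('a, 'b) K" is uminus
  by (rule ideal_rel_uminus)
lift_definition minus_K :: "('a, 'b) K \<Rightarrow> ('a, 'b) K \<Rightarrow> ('a, 'b) K" is "(-)"
  by (rule ideal_rel_diff)
lift_definition times_K :: "('a, 'b) K \<Rightarrow> ('a, 'b) K \<Rightarrow> ('a, 'b) K" is "(*)"
  by (rule ideal_rel_mult)

instance
proof
  show "(0 :: ('a, 'b) K) \<noteq> 1"
    by transfer (rule K_one_nontrivial)
qed (transfer; simp add: ideal_rel_refl algebra_simps)+

end

lift_definition scaleK :: "'k::field \<Rightarrow> ('k, 'n) K \<Rightarrow> ('k, 'n) K" is
  "\<lambda>c p. Poly_Mapping.single 0 c * p"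
  by (intro ideal_rel_mult ideal_rel_refl)

global_interpretation K: vector_space "scaleK :: 'k::field \<Rightarrow> ('k, 'n) K \<Rightarrow> ('k, 'n) K"
  by standard
     (transfer; simp add: ideal_rel_refl distrib_left distrib_right single_add mult_single flip: mult.assoc)+

lift_definition w :: "'n \<Rightarrow> ('k::field, 'n) K" is Kvar .

lemma w_square: "w i ^ 2 + w i = (0 :: ('k::field, 'n) K)"
proof -
  have "w i * w i + w i = (0 :: ('k::field, 'n) K)"
    by transfer (rule ideal_rel_generator, auto simp: K_relators_def power2_eq_square)
  then show ?thesis
    by (simp add: power2_eq_square)
qed

lemma scaleK_mult: "scaleK c x * y = scaleK c (x * y)" "x * scaleK c y = scaleK c (x * y)"
  by (transfer; simp add: ideal_rel_refl mult_ac)+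


section \<open>The algebra \<open>Q\<^sub>n\<close>\<close>

text \<open>
  The free associative unital algebra over \<open>'k\<close> on the generators \<open>'g\<close> is the monoid algebra
  \<open>'g word \<Rightarrow>\<^sub>0 'k\<close> of the free monoid, which is written additively because the library product
  on \<open>\<Rightarrow>\<^sub>0\<close> is the convolution over an additive monoid.
\<close>

datatype 'g word = Word (letters: "'g list")

instantiation word :: (type) monoid_add
begin

definition "0 = Word []"

definition "u + v = Word (letters u @ letters v)"

instance
  by standard (auto simp: zero_word_def plus_word_def)

end

lemma letters_zero [simp]: "letters 0 = []"
  and letters_plus [simp]: "letters (u + v) = letters u @ letters v"
  by (simp_all add: zero_word_def plus_word_def)

typedef 'n gen = "{(A :: 'n set, i). i \<notin> A}"
  by auto

text \<open>\<open>zfree A i\<close> is meaningful only for \<open>i \<notin> A\<close>.\<close>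

definition zfree :: "'n set \<Rightarrow> 'n \<Rightarrow> ('n gen word \<Rightarrow>\<^sub>0 'k::field)" where
  "zfree A i = Poly_Mapping.single (Word [Abs_gen (A, i)]) 1"

definition Q_relators :: "('n gen word \<Rightarrow>\<^sub>0 'k::field) set" where
  "Q_relators =
     {(zfree (A \<union> {i}) j + zfree A i) - (zfree (A \<union> {j}) i + zfree A j) | A i j.
        i \<notin> A \<and> j \<notin> A \<and> i \<noteq> j} \<union>
     {zfree (A \<union> {i}) j * zfree A i - zfree (A \<union> {j}) i * zfree A j | A i j.
        i \<notin> A \<and> j \<notin> A \<and> i \<noteq> j}"

quotient_type (overloaded) ('k, 'n) Q = "'n gen word \<Rightarrow>\<^sub>0 'k::field" / "ideal_rel Q_relators"
  by (rule ideal_rel_equivp)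

definition phi_free :: "('n::finite gen word \<Rightarrow>\<^sub>0 'k::field) \<Rightarrow> ('k, 'n) K" where
  "phi_free = monoid_algebra_eval (\<lambda>c. scaleK c 1)
     (\<lambda>u. prod_list (map (\<lambda>g. case Rep_gen g of (A, i) \<Rightarrow> w i * (\<Prod>j\<in>A. 1 + w j)) (letters u)))"

global_interpretation phi_free: monoid_algebra_hom "\<lambda>c::'k::field. scaleK c (1 :: ('k, 'n::finite) K)"
  "\<lambda>u. prod_list (map (\<lambda>g. case Rep_gen g of (A, i) \<Rightarrow> w i * (\<Prod>j\<in>A. 1 + w j)) (letters u))"
  rewrites "monoid_algebra_eval (\<lambda>c::'k::field. scaleK c (1 :: ('k, 'n::finite) K))
    (\<lambda>u. prod_list (map (\<lambda>g. case Rep_gen g of (A, i) \<Rightarrow> w i * (\<Prod>j\<in>A. 1 + w j)) (letters u)))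
    \<equiv> phi_free"
  by (standard; simp add: K.scale_left_distrib scaleK_mult) (simp add: phi_free_def)

lemma phi_free_zfree:
  fixes A :: "'n::finite set"
  assumes "i \<notin> A"
  shows "phi_free (zfree A i) = (w i * (\<Prod>j\<in>A. 1 + w j) :: ('k::field, 'n) K)"
  using assms by (simp add: zfree_def phi_free.eval_single Abs_gen_inverse)

lemma phi_free_relators:
  assumes "s \<in> (Q_relators :: ('n::finite gen word \<Rightarrow>\<^sub>0 'k::field) set)"
  shows "phi_free s = 0"
proof -
  have sq: "w i * (1 + w i) = (0 :: ('k, 'n) K)" for i
    using w_square[of i, where 'k = 'k] by (simp add: algebra_simps power2_eq_square)
  from assms consider
      A i j where "i \<notin> A" "j \<notin> A" "i \<noteq> j"
        "s = (zfree (A \<union> {i}) j + zfree A i) - (zfree (A \<union> {j}) i + zfree A j)"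
    | A i j where "i \<notin> A" "j \<notin> A" "i \<noteq> j"
        "s = zfree (A \<union> {i}) j * zfree A i - zfree (A \<union> {j}) i * zfree A j"
    unfolding Q_relators_def by blast
  then show ?thesis
  proof cases
    case 1
    let ?P = "\<Prod>j\<in>A. 1 + w j :: ('k, 'n) K"
    have "phi_free s = w j * ((1 + w i) * ?P) + w i * ?P - (w i * ((1 + w j) * ?P) + w j * ?P)"
      using 1 by (simp add: phi_free.eval_add phi_free.eval_diff phi_free_zfree)
    then show ?thesis
      by (simp add: algebra_simps)
  next
    case 2
    let ?P = "\<Prod>j\<in>A. 1 + w j :: ('k, 'n) K"
    have "phi_free s = w j * ((1 + w i) * ?P) * (w i * ?P) - w i * ((1 + w j) * ?P) * (w j * ?P)"
      using 2 by (simp add: phi_free.eval_mult phi_free.eval_diff phi_free_zfree)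
    also have "\<dots> = (w i * (1 + w i)) * (w j * ?P * ?P) - (w j * (1 + w j)) * (w i * ?P * ?P)"
      by (simp add: mult_ac)
    finally show ?thesis
      by (simp add: sq)
  qed
qed

lemma phi_free_ideal_rel: "ideal_rel Q_relators p q \<Longrightarrow> phi_free p = phi_free q"
  by (rule phi_free.eval_ideal_rel) (simp_all add: phi_free_relators)

instantiation Q :: (field, finite) ring_1
begin

lift_definition zero_Q :: "('a, 'b) Q" is 0 .
lift_definition one_Q :: "('a, 'b) Q" is 1 .
lift_definition plus_Q :: "('a, 'b) Q \<Rightarrow> ('a, 'b) Q \<Rightarrow> ('a, 'b) Q" is "(+)"
  by (rule ideal_rel_add)
lift_definition uminus_Q :: "('a, 'b) Q \<Rightarrow> ('a, 'b) Q" is uminus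
  by (rule ideal_rel_uminus)
lift_definition minus_Q :: "('a, 'b) Q \<Rightarrow> ('a, 'b) Q \<Rightarrow> ('a, 'b) Q" is "(-)"
  by (rule ideal_rel_diff)
lift_definition times_Q :: "('a, 'b) Q \<Rightarrow> ('a, 'b) Q \<Rightarrow> ('a, 'b) Q" is "(*)"
  by (rule ideal_rel_mult)

instance
proof
  have "\<not> ideal_rel (Q_relators :: ('b gen word \<Rightarrow>\<^sub>0 'a) set) 0 1"
    using phi_free_ideal_rel[of "0 :: 'b gen word \<Rightarrow>\<^sub>0 'a" 1]
    by (auto simp: phi_free.eval_zero phi_free.eval_one)
  then show "(0 :: ('a, 'b) Q) \<noteq> 1"
    by transfer
qed (transfer; simp add: ideal_rel_refl algebra_simps)+

end

lift_definition scaleQ :: "'k::field \<Rightarrow> ('k, 'n) Q \<Rightarrow> ('k, 'n) Q" is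
  "\<lambda>c p. Poly_Mapping.single 0 c * p"
  by (intro ideal_rel_mult ideal_rel_refl)

global_interpretation Q: vector_space "scaleQ :: 'k::field \<Rightarrow> ('k, 'n::finite) Q \<Rightarrow> ('k, 'n) Q"
  by standard
     (transfer; simp add: ideal_rel_refl distrib_left distrib_right single_add mult_single flip: mult.assoc)+

lemma scaleQ_mult:
  fixes x y :: "('k::field, 'n::finite) Q"
  shows "scaleQ c x * y = scaleQ c (x * y)" "x * scaleQ c y = scaleQ c (x * y)"
  by (transfer; metis ideal_rel_refl mult.assoc single_zero_central)+

lift_definition zgen :: "'n set \<Rightarrow> 'n \<Rightarrow> ('k::field, 'n) Q" is zfree .

lemma zgen_relations:
  fixes A :: "'n::finite set"
  assumes "i \<notin> A" "j \<notin> A" "i \<noteq> j"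
  shows "zgen (A \<union> {i}) j + zgen A i = (zgen (A \<union> {j}) i + zgen A j :: ('k::field, 'n) Q)"
    and "zgen (A \<union> {i}) j * zgen A i = (zgen (A \<union> {j}) i * zgen A j :: ('k::field, 'n) Q)"
  using assms by (transfer, intro ideal_rel_generator, unfold Q_relators_def, blast)+


section \<open>The spaces \<open>T\<^sub>n\<close> and the elements \<open>z\<^bsub>A,B\<^esub>\<close>\<close>

definition T :: "('k::field, 'n::finite) Q set" where
  "T = Q.span {zgen A i | A i. i \<notin> A}"

definition Tbar :: "('k::field, 'n::finite) Q set" where
  "Tbar = {t + scaleQ c 1 | t c. t \<in> T}"

lift_definition phi :: "('k::field, 'n::finite) Q \<Rightarrow> ('k, 'n) K" is phi_free
  by (rule phi_free_ideal_rel)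

lemma phi_hom:
  fixes x y :: "('k::field, 'n::finite) Q"
  shows "phi (x + y) = phi x + phi y" "phi (x * y) = phi x * phi y" "phi (1 :: ('k, 'n) Q) = 1"
    and "phi (scaleQ c x) = scaleK c (phi x)"
proof -
  show "phi (x + y) = phi x + phi y"
    by transfer (rule phi_free.eval_add)
  show "phi (x * y) = phi x * phi y"
    by transfer (rule phi_free.eval_mult)
  show "phi (1 :: ('k, 'n) Q) = 1"
    by transfer (rule phi_free.eval_one)
  show "phi (scaleQ c x) = scaleK c (phi x)"
    by transfer (simp add: phi_free.eval_mult phi_free.eval_single scaleK_mult)
qed

lemma phi_zgen:
  fixes A :: "'n::finite set"
  assumes "i \<notin> A"
  shows "phi (zgen A i) = (w i * (\<Prod>j\<in>A. 1 + w j) :: ('k::field, 'n) K)"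
  using assms by transfer (rule phi_free_zfree)

text \<open>
  The following two definitions are meaningful because \<open>Tbar\<close> is the direct sum of \<open>T\<close> and \<open>k\<cdot>1\<close>,
  and \<open>phi\<close> maps \<open>Tbar\<close> bijectively onto \<open>K\<^sub>n\<close>; neither fact is proved here.
\<close>

definition proj_T :: "('k::field, 'n::finite) Q \<Rightarrow> ('k, 'n) Q" where
  "proj_T x = (THE t. t \<in> T \<and> (\<exists>c. x = t + scaleQ c 1))"

definition z :: "'n::finite set \<Rightarrow> 'n set \<Rightarrow> ('k::field, 'n) Q" where
  "z A B = proj_T (the_inv_into Tbar phi ((\<Prod>i\<in>B. w i) * (\<Prod>j\<in>A. 1 + w j)))"

text \<open>
  A family \<open>(b\<^sub>i)\<close>, \<open>i \<in> I\<close>, is a basis of \<open>V\<close>. As a family it has no repeated members.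
\<close>

definition family_basis :: "'i set \<Rightarrow> ('i \<Rightarrow> ('k::field, 'n::finite) Q) \<Rightarrow> ('k, 'n) Q set \<Rightarrow> bool" where
  "family_basis I b V \<longleftrightarrow> inj_on b I \<and> Q.independent (b ` I) \<and> Q.span (b ` I) = V"

end

theory Submission
  imports Defs
begin

text \<open>
  The linear relations of \<open>Q\<^sub>n\<close> say that \<open>(A, i) \<mapsto> z\<^bsub>A,i\<^esub>\<close> is a closed 1-cochain on the cube of
  subsets: along the two paths from \<open>A\<close> to \<open>A \<union> {i, j}\<close> it has the same sum. Hence it has a
  potential \<open>P\<close>, normalised by \<open>P \<emptyset> = 0\<close>, with \<open>z\<^bsub>A,i\<^esub> = P (A \<union> {i}) - P A\<close>, and the \<open>2\<^sup>n - 1\<close>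
  elements \<open>P A\<close>, \<open>A \<noteq> \<emptyset>\<close>, span \<open>T\<^sub>n\<close>. Telescoping gives \<open>\<phi> (P A) = m\<^sub>A - 1\<close>, where
  \<open>m\<^sub>A = \<Prod>\<^bsub>j\<in>A\<^esub> (1 + w\<^sub>j)\<close>.

  The relation \<open>w\<^sub>i\<^sup>2 + w\<^sub>i = 0\<close> lets us evaluate \<open>K\<^sub>n\<close> at the points with coordinates \<open>0\<close> and \<open>-1\<close>.
  A point is given by the set \<open>U\<close> of its zero coordinates, and there \<open>m\<^sub>A\<close> takes the value \<open>1\<close> if
  \<open>A \<subseteq> U\<close> and \<open>0\<close> otherwise. Moebius inversion on the subset lattice therefore yields linear
  functionals on \<open>K\<^sub>n\<close> dual to the family \<open>m\<close> (lemma \<open>coeff_m\<close>). They show that the \<open>P A\<close>,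
  \<open>A \<noteq> \<emptyset>\<close>, are a basis of \<open>T\<^sub>n\<close>, and \<open>m\<^sub>A \<mapsto> P A\<close> defines a linear map \<open>R\<close> from \<open>K\<^sub>n\<close> to \<open>T\<^sub>n\<close>
  which kills \<open>1\<close> and inverts \<open>\<phi>\<close> on \<open>T\<^sub>n\<close>. So, for disjoint \<open>A\<close> and \<open>B\<close>, \<open>z\<^bsub>A,B\<^esub>\<close> is the value of \<open>R\<close> at
  \<open>\<Prod>\<^bsub>i\<in>B\<^esub> w\<^sub>i \<cdot> m\<^sub>A\<close> (lemma \<open>z_eq_R\<close>), and linear identities between such products in \<open>K\<^sub>n\<close>
  become linear identities in \<open>T\<^sub>n\<close>.

  Since \<open>dim T\<^sub>n = 2\<^sup>n - 1\<close>, each of the three families is a basis as soon as it spans every \<open>P A\<close>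
  with \<open>A \<noteq> \<emptyset>\<close>. This follows from three expressions for \<open>m\<^sub>A\<close>: it is \<open>m\<^sub>A\<close> itself; it is the sum
  of the products \<open>\<Prod>\<^bsub>i\<in>B\<^esub> w\<^sub>i\<close> over \<open>B \<subseteq> A\<close>; and, multiplying by \<open>1 = (1 + w\<^sub>i) - w\<^sub>i\<close> for every
  \<open>i \<notin> A\<close>, it is a signed sum of the products \<open>\<Prod>\<^bsub>i\<notin>B\<^esub> w\<^sub>i \<cdot> m\<^sub>B\<close> over \<open>B \<supseteq> A\<close>,
  and such \<open>B\<close> are nonempty because \<open>A\<close> is.
\<close>

section \<open>Evaluation and Moebius inversion on \<open>K\<^sub>n\<close>\<close>

definition m :: "'n::finite set \<Rightarrow> ('k::field, 'n) K" where
  "m A = (\<Prod>j\<in>A. 1 + w j)"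

definition monom_at :: "'n::finite set \<Rightarrow> ('n \<Rightarrow>\<^sub>0 nat) \<Rightarrow> 'k::field" where
  "monom_at U u = (\<Prod>i\<in>UNIV. (if i \<in> U then 0 else - 1) ^ Poly_Mapping.lookup u i)"

lemma monom_at_single: "monom_at U (Poly_Mapping.single i 1) = (if i \<in> U then 0 else - 1 :: 'k::field)"
proof -
  have "monom_at U (Poly_Mapping.single i 1) =
      (\<Prod>j\<in>UNIV. if j = i then (if i \<in> U then 0 else - 1) else 1 :: 'k)"
    unfolding monom_at_def by (rule prod.cong) (auto simp: lookup_single when_def)
  then show ?thesis by simp
qed

definition chi_free :: "'n::finite set \<Rightarrow> (('n \<Rightarrow>\<^sub>0 nat) \<Rightarrow>\<^sub>0 'k::field) \<Rightarrow> 'k" where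
  "chi_free U = monoid_algebra_eval (\<lambda>c. c) (monom_at U)"

lemma monom_at_hom: "monoid_algebra_hom (\<lambda>c::'k::field. c) (monom_at U)"
  by standard (simp_all add: monom_at_def lookup_add power_add prod.distrib mult.commute)

text \<open>The subset \<open>U\<close> stands for the point whose coordinates vanish exactly on \<open>U\<close>.\<close>

lift_definition chi :: "'n::finite set \<Rightarrow> ('k::field, 'n) K \<Rightarrow> 'k" is chi_free
proof -
  fix U :: "'n set" and p q :: "('n \<Rightarrow>\<^sub>0 nat) \<Rightarrow>\<^sub>0 'k"
  interpret monoid_algebra_hom "\<lambda>c::'k. c" "monom_at U :: _ \<Rightarrow> 'k"
    by (rule monom_at_hom)
  have "ev s = 0" if "s \<in> K_relators" for s :: "('n \<Rightarrow>\<^sub>0 nat) \<Rightarrow>\<^sub>0 'k"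
    using that monom_at_single[of U, where 'k = 'k]
    by (auto simp: K_relators_def Kvar_def eval_add eval_mult power2_eq_square eval_single)
  moreover assume "ideal_rel K_relators p q"
  ultimately show "chi_free U p = chi_free U q"
    unfolding chi_free_def by (rule eval_ideal_rel)
qed

lemma chi_hom:
  fixes x y :: "('k::field, 'n::finite) K"
  shows "chi U (x + y) = chi U x + chi U y" "chi U (x * y) = chi U x * chi U y"
    and "chi U (1 :: ('k, 'n) K) = 1" "chi U (scaleK c x) = c * chi U x"
    and "chi U (w i :: ('k, 'n) K) = (if i \<in> U then 0 else - 1)"
proof -
  interpret monoid_algebra_hom "\<lambda>c::'k. c" "monom_at U :: _ \<Rightarrow> 'k"
    by (rule monom_at_hom)
  have h0: "monom_at U 0 = (1 :: 'k)"
    by (rule h_zero)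
  show "chi U (x + y) = chi U x + chi U y"
    by transfer (simp add: chi_free_def monoid_algebra_hom.eval_add[OF monom_at_hom])
  show "chi U (x * y) = chi U x * chi U y"
    by transfer (simp add: chi_free_def monoid_algebra_hom.eval_mult[OF monom_at_hom])
  show "chi U (1 :: ('k, 'n) K) = 1"
    by transfer (simp add: chi_free_def monoid_algebra_hom.eval_one[OF monom_at_hom])
  show "chi U (scaleK c x) = c * chi U x"
    using h0 by transfer (simp add: chi_free_def monoid_algebra_hom.eval_mult[OF monom_at_hom]
        monoid_algebra_hom.eval_single[OF monom_at_hom])
  show "chi U (w i :: ('k, 'n) K) = (if i \<in> U then 0 else - 1)"
    using monom_at_single[of U i, where 'k = 'k]
    by transfer (simp add: chi_free_def Kvar_def monoid_algebra_hom.eval_single[OF monom_at_hom])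
qed

lemma chi_m: "chi U (m A :: ('k::field, 'n::finite) K) = of_bool (A \<subseteq> U)"
proof -
  have "finite A" by simp
  then show ?thesis
    unfolding m_def by (induction A) (auto simp: chi_hom)
qed

definition coeff :: "'n::finite set \<Rightarrow> ('k::field, 'n) K \<Rightarrow> 'k" where
  "coeff A x = (\<Sum>U\<in>Pow A. (- 1) ^ card (A - U) * chi U x)"

lemma coeff_add: "coeff A (x + y) = coeff A x + coeff A y"
  by (simp add: coeff_def chi_hom distrib_left sum.distrib)

lemma coeff_scale: "coeff A (scaleK c x) = c * coeff A x"
  by (simp add: coeff_def chi_hom sum_distrib_left mult.left_commute)

lemma coeff_linear: "Vector_Spaces.linear scaleK (*) (coeff A :: ('k::field, 'n::finite) K \<Rightarrow> 'k)"
  by unfold_locales (simp_all add: coeff_add coeff_scale distrib_left distrib_right mult.assoc)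

text \<open>
  The alternating sum of \<open>chi U (m B)\<close> over \<open>U \<subseteq> A\<close> runs over the interval from \<open>B\<close> to \<open>A\<close>. It is
  the expansion of a product over \<open>A\<close> whose factor at \<open>i\<close> is \<open>1\<close> if \<open>i \<in> B\<close>, and \<open>1 - 1\<close> otherwise.
\<close>

lemma coeff_m: "coeff A (m B :: ('k::field, 'n::finite) K) = of_bool (A = B)"
proof (cases "B \<subseteq> A")
  case True
  have prod_neg: "(\<Prod>i\<in>X. - of_bool (i \<notin> B) :: 'k) = (- 1) ^ card X * of_bool (X \<inter> B = {})"
    for X :: "'n set"
  proof -
    have "finite X" by simp
    then have "(\<Prod>i\<in>X. of_bool (i \<notin> B) :: 'k) = of_bool (X \<inter> B = {})"
      by (induction X) auto
    then show ?thesis by (simp add: prod_uminus)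
  qed
  have "coeff A (m B :: ('k, 'n) K) =
      (\<Sum>U\<in>Pow A. (\<Prod>i\<in>U. 1) * (\<Prod>i\<in>A - U. - of_bool (i \<notin> B)))"
    unfolding coeff_def chi_m prod_neg
  proof (rule sum.cong)
    fix U assume "U \<in> Pow A"
    then have "B \<subseteq> U \<longleftrightarrow> (A - U) \<inter> B = {}"
      using True by blast
    then show "(- 1) ^ card (A - U) * of_bool (B \<subseteq> U) =
        (\<Prod>i\<in>U. 1) * ((- 1) ^ card (A - U) * of_bool ((A - U) \<inter> B = {}) :: 'k)"
      by simp
  qed simp
  also have "\<dots> = (\<Prod>i\<in>A. 1 + - of_bool (i \<notin> B))"
    by (rule prod_add[symmetric]) simp
  also have "\<dots> = (\<Prod>i\<in>A. of_bool (i \<in> B))"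
    by (rule prod.cong) auto
  also have "\<dots> = of_bool (A \<subseteq> B)"
  proof -
    have "finite A" by simp
    then show ?thesis by (induction A) auto
  qed
  also have "A \<subseteq> B \<longleftrightarrow> A = B"
    using True by blast
  finally show ?thesis .
next
  case False
  then have "chi U (m B :: ('k, 'n) K) = 0" if "U \<in> Pow A" for U
    using that by (auto simp: chi_m)
  with False show ?thesis
    by (auto simp: coeff_def)
qed

section \<open>The potential on the cube\<close>

text \<open>
  The state carries the set reached so far, because the increment depends on it. Adding an element
  twice does nothing, and the linear relations of \<open>Q\<^sub>n\<close> make the additions commute.
\<close>

definition climb :: "'n::finite \<Rightarrow> 'n set \<times> ('k::field, 'n) Q \<Rightarrow> 'n set \<times> ('k, 'n) Q" where
  "climb i = (\<lambda>(A, x). if i \<in> A then (A, x) else (insert i A, x + zgen A i))"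

lemma climb_commute: "comp_fun_commute (climb :: _ \<Rightarrow> _ \<times> ('k::field, 'n::finite) Q \<Rightarrow> _)"
proof
  fix i j :: 'n
  have "climb j (climb i (A, x)) = climb i (climb j (A, x))" for A and x :: "('k, 'n) Q"
  proof (cases "i \<in> A \<or> j \<in> A \<or> i = j")
    case True
    then show ?thesis by (auto simp: climb_def)
  next
    case False
    then have "zgen (insert i A) j + zgen A i = (zgen (insert j A) i + zgen A j :: ('k, 'n) Q)"
      using zgen_relations(1)[of i A j, where 'k = 'k] by simp
    with False show ?thesis
      by (auto simp: climb_def insert_commute add.assoc) (simp add: add.commute)
  qed
  then show "climb j \<circ> climb i = (climb i \<circ> climb j :: _ \<times> ('k, 'n) Q \<Rightarrow> _)"
    by (auto simp: fun_eq_iff)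
qed

definition P :: "'n::finite set \<Rightarrow> ('k::field, 'n) Q" where
  "P A = snd (Finite_Set.fold climb ({}, 0) A)"

lemma P_empty [simp]: "P {} = 0"
  by (simp add: P_def)

lemma P_insert:
  fixes A :: "'n::finite set"
  assumes "i \<notin> A"
  shows "P (insert i A) = (P A + zgen A i :: ('k::field, 'n) Q)"
proof -
  interpret comp_fun_commute "climb :: _ \<Rightarrow> _ \<times> ('k, 'n) Q \<Rightarrow> _"
    by (rule climb_commute)
  have fst_climb: "fst (climb j s) = insert j (fst s)" for j and s :: "'n set \<times> ('k, 'n) Q"
    by (cases s) (auto simp: climb_def)
  have "finite A" by simp
  then have fst_fold: "fst (Finite_Set.fold climb ({}, 0 :: ('k, 'n) Q) A) = A"
    by (induction A) (simp_all add: fst_climb)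
  have snd_climb: "snd (climb i s) = snd s + zgen (fst s) i"
    if "i \<notin> fst s" for s :: "'n set \<times> ('k, 'n) Q"
    using that by (cases s) (simp add: climb_def)
  show ?thesis
    using assms by (simp add: P_def snd_climb fst_fold)
qed

lemma T_eq_span_P: "(T :: ('k::field, 'n::finite) Q set) = Q.span (P ` {A. A \<noteq> {}})"
proof
  have P_in: "(P A :: ('k, 'n) Q) \<in> Q.span (P ` {A. A \<noteq> {}})" for A
    by (cases "A = {}") (auto intro: Q.span_base Q.span_zero)
  have "(zgen A i :: ('k, 'n) Q) \<in> Q.span (P ` {A. A \<noteq> {}})" if "i \<notin> A" for A i
    using Q.span_diff[OF P_in[of "insert i A"] P_in[of A]] P_insert[OF that, where 'k = 'k] by simp
  then show "(T :: ('k, 'n) Q set) \<subseteq> Q.span (P ` {A. A \<noteq> {}})"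
    unfolding T_def by (intro Q.span_minimal) auto
  have "(P A :: ('k, 'n) Q) \<in> T" for A
  proof -
    have "finite A" by simp
    then show ?thesis
      unfolding T_def
    proof (induction A)
      case empty
      show ?case by (simp add: Q.span_zero)
    next
      case (insert i A)
      have "(zgen A i :: ('k, 'n) Q) \<in> Q.span {zgen A i | A i. i \<notin> A}"
        using insert by (intro Q.span_base) blast
      with insert show ?case by (simp add: P_insert Q.span_add)
    qed
  qed
  then show "Q.span (P ` {A. A \<noteq> {}}) \<subseteq> (T :: ('k, 'n) Q set)"
    by (intro Q.span_minimal) (auto simp: T_def)
qed

lemma subspace_T: "Q.subspace T"
  by (simp add: T_def)

lemma P_in_T: "P A \<in> T"
  by (cases "A = {}") (auto simp: T_eq_span_P intro: Q.span_base Q.span_zero)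

lemma phi_linear: "Vector_Spaces.linear scaleQ scaleK (phi :: ('k::field, 'n::finite) Q \<Rightarrow> _)"
  by unfold_locales (simp_all add: phi_hom)

lemma phi_P: "phi (P A) = (m A - 1 :: ('k::field, 'n::finite) K)"
proof -
  interpret phi: Vector_Spaces.linear scaleQ scaleK "phi :: ('k, 'n) Q \<Rightarrow> _"
    by (rule phi_linear)
  have "finite A" by simp
  then show ?thesis
    by (induction A) (simp_all add: P_insert phi.add phi.zero phi_zgen m_def algebra_simps)
qed

text \<open>
  The constant in \<open>phi (P B) = m B - 1\<close> is \<open>m {}\<close>, which only the functional \<open>coeff {}\<close> detects. The
  functionals \<open>coeff A \<circ> phi\<close> with \<open>A \<noteq> {}\<close> are therefore dual to the potentials.
\<close>

lemma coeff_phi_P: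
  assumes "A \<noteq> {}"
  shows "coeff A (phi (P B :: ('k::field, 'n::finite) Q)) = of_bool (A = B)"
proof -
  interpret c: Vector_Spaces.linear scaleK "(*)" "coeff A :: ('k, 'n) K \<Rightarrow> 'k"
    by (rule coeff_linear)
  have "m {} = (1 :: ('k, 'n) K)"
    by (simp add: m_def)
  then have "coeff A (1 :: ('k, 'n) K) = 0"
    using assms coeff_m[of A "{}", where 'k = 'k] by simp
  then show ?thesis
    by (simp add: phi_P c.diff coeff_m)
qed

lemma P_family_basis: "family_basis {A. A \<noteq> {}} P (T :: ('k::field, 'n::finite) Q set)"
  unfolding family_basis_def
proof (intro conjI)
  show "inj_on (P :: _ \<Rightarrow> ('k, 'n) Q) {A. A \<noteq> {}}"
  proof (rule inj_onI)
    fix A B :: "'n set"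
    assume "A \<in> {A. A \<noteq> {}}" and eq: "P A = (P B :: ('k, 'n) Q)"
    then have A: "A \<noteq> {}" by simp
    have "of_bool (A = B) = coeff A (phi (P B :: ('k, 'n) Q))"
      by (rule coeff_phi_P[OF A, symmetric])
    also have "\<dots> = coeff A (phi (P A :: ('k, 'n) Q))"
      by (simp only: eq)
    also have "\<dots> = 1"
      by (simp add: coeff_phi_P[OF A])
    finally show "A = B" by (simp split: if_splits)
  qed
  show "Q.independent (P ` {A. A \<noteq> {}} :: ('k, 'n) Q set)"
    unfolding Q.dependent_def
  proof
    assume "\<exists>a\<in>P ` {A. A \<noteq> {}}. a \<in> Q.span (P ` {A. A \<noteq> {}} - {a :: ('k, 'n) Q})"
    then obtain A :: "'n set" where A: "A \<noteq> {}"
      and in_span: "(P A :: ('k, 'n) Q) \<in> Q.span (P ` {A. A \<noteq> {}} - {P A})"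
      by blast
    interpret phi: Vector_Spaces.linear scaleQ scaleK "phi :: ('k, 'n) Q \<Rightarrow> _"
      by (rule phi_linear)
    interpret c: Vector_Spaces.linear scaleK "(*)" "coeff A :: ('k, 'n) K \<Rightarrow> 'k"
      by (rule coeff_linear)
    have "Q.subspace {t :: ('k, 'n) Q. coeff A (phi t) = 0}"
      by (simp add: Q.subspace_def phi.add phi.zero phi.scale c.add c.zero c.scale)
    then have "Q.span (P ` {A. A \<noteq> {}} - {P A}) \<subseteq> {t :: ('k, 'n) Q. coeff A (phi t) = 0}"
      by (intro Q.span_minimal) (auto simp: coeff_phi_P[OF A])
    with in_span have "coeff A (phi (P A :: ('k, 'n) Q)) = 0"
      by blast
    then show False
      by (simp add: coeff_phi_P[OF A])
  qed
qed (rule T_eq_span_P[symmetric])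

section \<open>The inverse of \<open>\<phi>\<close>\<close>

definition R :: "('k::field, 'n::finite) K \<Rightarrow> ('k, 'n) Q" where
  "R x = (\<Sum>A\<in>UNIV. scaleQ (coeff A x) (P A))"

lemma R_linear: "Vector_Spaces.linear scaleK scaleQ (R :: ('k::field, 'n::finite) K \<Rightarrow> _)"
  by unfold_locales
     (simp_all add: R_def coeff_add coeff_scale Q.scale_left_distrib sum.distrib Q.scale_sum_right)

interpretation R: Vector_Spaces.linear scaleK scaleQ "R :: ('k::field, 'n::finite) K \<Rightarrow> _"
  by (rule R_linear)

lemma R_m: "R (m A) = P A"
proof -
  have "R (m A) = (\<Sum>B\<in>UNIV. if B = A then P B else 0)"
    unfolding R_def by (rule sum.cong) (auto simp: coeff_m)
  then show ?thesis by simp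
qed

lemma R_one: "R (1 :: ('k::field, 'n::finite) K) = 0"
proof -
  have "m {} = (1 :: ('k, 'n) K)"
    by (simp add: m_def)
  then have "R (1 :: ('k, 'n) K) = P {}"
    by (metis R_m)
  then show ?thesis by simp
qed

lemma R_in_T: "R x \<in> T"
  unfolding R_def
  by (rule Q.subspace_sum[OF subspace_T], rule Q.subspace_scale[OF subspace_T], rule P_in_T)

lemma R_phi:
  fixes t :: "('k::field, 'n::finite) Q"
  assumes "t \<in> T"
  shows "R (phi t) = t"
proof -
  interpret phi: Vector_Spaces.linear scaleQ scaleK "phi :: ('k, 'n) Q \<Rightarrow> _"
    by (rule phi_linear)
  have "Q.subspace {t :: ('k, 'n) Q. R (phi t) = t}"
    by (simp add: Q.subspace_def phi.add phi.zero phi.scale R.add R.zero R.scale)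
  then have "Q.span (P ` {A. A \<noteq> {}}) \<subseteq> {t :: ('k, 'n) Q. R (phi t) = t}"
    by (intro Q.span_minimal) (auto simp: phi_P R.diff R_m R_one)
  with assms show ?thesis
    by (auto simp: T_eq_span_P)
qed

text \<open>\<open>R\<close> recovers the \<open>T\<close>-component of a preimage, so \<open>T + k\<cdot>1\<close> is direct and \<open>\<phi>\<close> is injective on it.\<close>

lemma proj_T_the_inv_phi:
  fixes y :: "('k::field, 'n::finite) Q"
  assumes "y \<in> Tbar"
  shows "proj_T (the_inv_into Tbar phi (phi y)) = R (phi y)"
proof -
  have R_phi_sum: "R (phi (t + scaleQ c 1)) = t" if "t \<in> T" for t :: "('k, 'n) Q" and c
    using that by (simp add: phi_hom R.add R.scale R_phi R_one)
  have "inj_on phi (Tbar :: ('k, 'n) Q set)"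
  proof (rule inj_onI)
    fix x x' :: "('k, 'n) Q"
    assume "x \<in> Tbar" "x' \<in> Tbar" and eq: "phi x = phi x'"
    then obtain t c t' c' where x: "x = t + scaleQ c 1" "t \<in> T" and x': "x' = t' + scaleQ c' 1" "t' \<in> T"
      unfolding Tbar_def by blast
    with eq R_phi_sum have "t = t'" by metis
    with eq x x' have "scaleK c (1 :: ('k, 'n) K) = scaleK c' 1"
      by (simp add: phi_hom)
    then have "c = c'"
      by (rule K.scale_right_imp_eq[rotated]) simp
    with \<open>t = t'\<close> x x' show "x = x'" by simp
  qed
  then have inv: "the_inv_into Tbar phi (phi y) = y"
    using assms by (rule the_inv_into_f_f)
  obtain t c where y: "y = t + scaleQ c 1" "t \<in> T"
    using assms unfolding Tbar_def by blast
  have "proj_T y = t"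
    unfolding proj_T_def
  proof (rule the_equality)
    show "t \<in> T \<and> (\<exists>c. y = t + scaleQ c 1)"
      using y by blast
    show "s = t" if "s \<in> T \<and> (\<exists>c. y = s + scaleQ c 1)" for s
      using that y R_phi_sum by metis
  qed
  with inv y R_phi_sum show ?thesis by simp
qed

lemma minus_one_power_mult: "(- 1) ^ k * x = scaleK ((- 1) ^ k) x"
  by (cases "even k") simp_all

text \<open>
  For disjoint \<open>A\<close> and \<open>B\<close>, expanding \<open>w\<^sub>i = (1 + w\<^sub>i) - 1\<close> for \<open>i \<in> B\<close> shows that the product which
  defines \<open>z A B\<close> lies in the span of the \<open>m C\<close>, hence in the image of \<open>T + k\<cdot>1\<close>.
\<close>

lemma z_eq_R:
  fixes A B :: "'n::finite set"
  assumes "A \<inter> B = {}"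
  shows "(z A B :: ('k::field, 'n) Q) = R ((\<Prod>i\<in>B. w i) * m A)"
proof -
  interpret phi: Vector_Spaces.linear scaleQ scaleK "phi :: ('k, 'n) Q \<Rightarrow> _"
    by (rule phi_linear)
  have sub: "Q.subspace (Tbar :: ('k, 'n) Q set)"
  proof -
    have "Q.subspace {x + y |x y. x \<in> T \<and> y \<in> Q.span {1 :: ('k, 'n) Q}}"
      by (rule Q.subspace_sums[OF subspace_T Q.subspace_span])
    also have "{x + y |x y. x \<in> T \<and> y \<in> Q.span {1 :: ('k, 'n) Q}} = Tbar"
      by (auto simp: Tbar_def Q.span_singleton)
    finally show ?thesis .
  qed
  have m_img: "(m C :: ('k, 'n) K) \<in> phi ` Tbar" for C
  proof -
    have "P C + scaleQ 1 1 \<in> (Tbar :: ('k, 'n) Q set)"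
      unfolding Tbar_def using P_in_T by blast
    moreover have "phi (P C + scaleQ 1 1 :: ('k, 'n) Q) = m C"
      by (simp add: phi_hom phi_P)
    ultimately show ?thesis
      by (metis imageI)
  qed
  have img: "K.subspace (phi ` Tbar :: ('k, 'n) K set)"
    by (rule phi.subspace_image[OF sub])
  have summand: "(\<Prod>i\<in>X. 1 + w i) * (\<Prod>i\<in>B - X. - 1) * m A \<in> (phi ` Tbar :: ('k, 'n) K set)"
    if "X \<subseteq> B" for X
  proof -
    have "(\<Prod>i\<in>X. 1 + w i) * m A = (m (X \<union> A) :: ('k, 'n) K)"
      unfolding m_def using that assms by (intro prod.union_disjoint[symmetric]) auto
    moreover have "(\<Prod>i\<in>X. 1 + w i) * (\<Prod>i\<in>B - X. - 1) * m A =
        (- 1) ^ card (B - X) * ((\<Prod>i\<in>X. 1 + w i) * m A :: ('k, 'n) K)"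
      by (simp add: mult_ac)
    ultimately have "(\<Prod>i\<in>X. 1 + w i) * (\<Prod>i\<in>B - X. - 1) * m A =
        scaleK ((- 1) ^ card (B - X)) (m (X \<union> A) :: ('k, 'n) K)"
      by (simp only: minus_one_power_mult)
    then show ?thesis
      using K.subspace_scale[OF img m_img] by simp
  qed
  have "(\<Prod>i\<in>B. w i :: ('k, 'n) K) = (\<Prod>i\<in>B. (1 + w i) + - 1)"
    by simp
  also have "\<dots> = (\<Sum>X\<in>Pow B. (\<Prod>i\<in>X. 1 + w i) * (\<Prod>i\<in>B - X. - 1))"
    by (rule prod_add) simp
  finally have "(\<Prod>i\<in>B. w i) * m A =
      (\<Sum>X\<in>Pow B. (\<Prod>i\<in>X. 1 + w i) * (\<Prod>i\<in>B - X. - 1) * m A :: ('k, 'n) K)"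
    by (simp only: sum_distrib_right)
  also have "\<dots> \<in> phi ` Tbar"
    using summand by (intro K.subspace_sum[OF img]) auto
  finally obtain y where y: "y \<in> Tbar" "(\<Prod>i\<in>B. w i) * m A = phi (y :: ('k, 'n) Q)"
    by blast
  then have "z A B = proj_T (the_inv_into Tbar phi (phi y))"
    by (simp add: z_def flip: m_def)
  with y show ?thesis
    by (simp add: proj_T_the_inv_phi)
qed

section \<open>Spanning families of the right size\<close>

text \<open>
  The index set has \<open>dim T\<close> elements, so a spanning family has neither repetitions nor linear
  dependences.
\<close>

lemma family_basis_T_if_spans_P:
  fixes b :: "'n::finite set \<Rightarrow> ('k::field, 'n) Q"
  assumes in_T: "\<And>A. A \<noteq> {} \<Longrightarrow> b A \<in> T"
    and spans: "\<And>A. A \<noteq> {} \<Longrightarrow> P A \<in> Q.span (b ` {A. A \<noteq> {}})"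
  shows "family_basis {A. A \<noteq> {}} b T"
proof -
  let ?I = "{A :: 'n set. A \<noteq> {}}"
  have P: "inj_on (P :: _ \<Rightarrow> ('k, 'n) Q) ?I" "Q.independent (P ` ?I :: ('k, 'n) Q set)"
    using P_family_basis unfolding family_basis_def by auto
  have span: "Q.span (b ` ?I) = T"
  proof
    show "Q.span (b ` ?I) \<subseteq> T"
      using in_T by (intro Q.span_minimal subspace_T) auto
    show "T \<subseteq> Q.span (b ` ?I)"
      unfolding T_eq_span_P using spans by (intro Q.span_minimal) auto
  qed
  \<comment> \<open>An independent subfamily spanning \<open>T\<close> is no smaller than the basis \<open>P\<close>, so nothing was dropped.\<close>
  obtain B where B: "B \<subseteq> b ` ?I" "Q.independent B" "b ` ?I \<subseteq> Q.span B"
    by (rule Q.maximal_independent_subset)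
  have "P ` ?I \<subseteq> Q.span (b ` ?I)"
    using spans by blast
  also have "\<dots> \<subseteq> Q.span B"
    using B(3) by (intro Q.span_minimal) auto
  finally have "card (P ` ?I :: ('k, 'n) Q set) \<le> card B"
    using P(2) finite_subset[OF B(1)] by (intro Q.independent_span_bound[THEN conjunct2]) auto
  then have le: "card ?I \<le> card B"
    using P(1) by (simp add: card_image)
  have "B = b ` ?I"
    using B(1) le card_image_le[of ?I b] by (intro card_seteq) auto
  moreover have "inj_on b ?I"
    using le card_image_le[of ?I b] \<open>B = b ` ?I\<close> by (intro eq_card_imp_inj_on) auto
  ultimately show ?thesis
    using B(2) span by (simp add: family_basis_def)
qed

lemma m_eq_sum_prod_w: "(m A :: ('k::field, 'n::finite) K) = (\<Sum>B\<in>Pow A. \<Prod>i\<in>B. w i)"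
proof -
  have "(m A :: ('k, 'n) K) = (\<Prod>i\<in>A. w i + 1)"
    by (simp only: m_def add.commute)
  also have "\<dots> = (\<Sum>B\<in>Pow A. (\<Prod>i\<in>B. w i) * (\<Prod>i\<in>A - B. 1))"
    by (rule prod_add) simp
  finally show ?thesis by simp
qed

text \<open>The products on the right are, up to sign, the primitive idempotents of \<open>K\<^sub>n\<close>.\<close>

lemma m_eq_sum_atoms:
  "(m A :: ('k::field, 'n::finite) K) =
     (\<Sum>X\<in>Pow (- A). scaleK ((- 1) ^ card (- A - X)) ((\<Prod>i\<in>- (A \<union> X). w i) * m (A \<union> X)))"
proof -
  have "(1 :: ('k, 'n) K) = (\<Prod>i\<in>- A. (1 + w i) + - w i)"
    by simp
  also have "\<dots> = (\<Sum>X\<in>Pow (- A). (\<Prod>i\<in>X. 1 + w i) * (\<Prod>i\<in>- A - X. - w i))"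
    by (rule prod_add) simp
  finally have one: "(1 :: ('k, 'n) K) =
      (\<Sum>X\<in>Pow (- A). (\<Prod>i\<in>X. 1 + w i) * (\<Prod>i\<in>- A - X. - w i))" .
  have "(m A :: ('k, 'n) K) = 1 * m A"
    by simp
  also have "\<dots> = (\<Sum>X\<in>Pow (- A). (\<Prod>i\<in>X. 1 + w i) * (\<Prod>i\<in>- A - X. - w i) * m A)"
    by (subst one) (rule sum_distrib_right)
  also have "\<dots> = (\<Sum>X\<in>Pow (- A). scaleK ((- 1) ^ card (- A - X)) ((\<Prod>i\<in>- (A \<union> X). w i) * m (A \<union> X)))"
  proof (rule sum.cong)
    fix X assume "X \<in> Pow (- A)"
    then have "(m (A \<union> X) :: ('k, 'n) K) = m A * (\<Prod>i\<in>X. 1 + w i)"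
      unfolding m_def by (intro prod.union_disjoint) auto
    moreover have "- A - X = - (A \<union> X)"
      by blast
    ultimately show "(\<Prod>i\<in>X. 1 + w i) * (\<Prod>i\<in>- A - X. - w i) * m A =
        (scaleK ((- 1) ^ card (- A - X)) ((\<Prod>i\<in>- (A \<union> X). w i) * m (A \<union> X)) :: ('k, 'n) K)"
      by (simp only: prod_uminus mult_ac flip: minus_one_power_mult)
  qed (rule refl)
  finally show ?thesis .
qed

theorem proposition1p2p7:
  shows "family_basis {A. A \<noteq> {}} (\<lambda>A. z A {}) (T :: ('k::field, 'n::finite) Q set) \<and>
    family_basis {A. A \<noteq> {}} (\<lambda>A. z {} A) (T :: ('k, 'n) Q set) \<and>
    family_basis {A. A \<noteq> {}} (\<lambda>A. z A (- A)) (T :: ('k, 'n) Q set)"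
proof (intro conjI; rule family_basis_T_if_spans_P)
  fix A :: "'n set"
  assume A: "A \<noteq> {}"
  show "(z A {} :: ('k, 'n) Q) \<in> T" "(z {} A :: ('k, 'n) Q) \<in> T" "(z A (- A) :: ('k, 'n) Q) \<in> T"
    by (simp_all add: z_eq_R R_in_T)
  show "(P A :: ('k, 'n) Q) \<in> Q.span ((\<lambda>A. z A {}) ` {A. A \<noteq> {}})"
    using A by (intro Q.span_base) (auto simp: z_eq_R R_m)
  have "(P A :: ('k, 'n) Q) = (\<Sum>B\<in>Pow A. z {} B)"
    by (subst R_m[symmetric], subst m_eq_sum_prod_w) (simp add: R.sum z_eq_R m_def)
  also have "\<dots> \<in> Q.span ((\<lambda>A. z {} A) ` {A. A \<noteq> {}})"
  proof (rule Q.span_sum)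
    fix B :: "'n set"
    \<comment> \<open>The constant term of \<open>m A\<close> is lost because \<open>R\<close> kills \<open>1\<close>.\<close>
    have "(z {} {} :: ('k, 'n) Q) = 0"
      by (simp add: z_eq_R R_m)
    then show "(z {} B :: ('k, 'n) Q) \<in> Q.span ((\<lambda>A. z {} A) ` {A. A \<noteq> {}})"
      by (cases "B = {}") (auto intro: Q.span_base Q.span_zero)
  qed
  finally show "(P A :: ('k, 'n) Q) \<in> Q.span ((\<lambda>A. z {} A) ` {A. A \<noteq> {}})" .
  have "(P A :: ('k, 'n) Q) =
      (\<Sum>X\<in>Pow (- A). scaleQ ((- 1) ^ card (- A - X)) (z (A \<union> X) (- (A \<union> X))))"
    by (subst R_m[symmetric], subst m_eq_sum_atoms) (simp only: R.sum R.scale z_eq_R Compl_disjoint)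
  also have "\<dots> \<in> Q.span ((\<lambda>A. z A (- A)) ` {A. A \<noteq> {}})"
    using A by (intro Q.span_sum Q.span_scale Q.span_base) blast
  finally show "(P A :: ('k, 'n) Q) \<in> Q.span ((\<lambda>A. z A (- A)) ` {A. A \<noteq> {}})" .
qed

end
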